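(* Let $E$ be a nonempty set, let $L$ be a linear class of real-valued functions on $E$ satisfying (L1) and (L2), and let $A:L\to\mathbb{R}$ be a functional satisfying (A1) and (A2). Let $p>1$ and $p^{-1}+q^{-1}=1$, and let $m\ge 1$ be an integer. Let $\alpha_1,\dots,\alpha_m,w,f,g:E\to\mathbb{R}$ be functions that are $\ge 0$ on $E$, with $\sum_{i=1}^{m}\alpha_i=1$ on $E$, such that $wfg\in L$ and $\alpha_i wfg,\ \alpha_i wf^{p},\ \alpha_i wg^{q}\in L$ for $i=1,2,\dots,m$. Then: (i) $$A(wfg)\le\sum_{i=1}^{m}A^{1/p}(\alpha_i wf^{p})\,A^{1/q}(\alpha_i wg^{q});$$ (ii) $$\sum_{i=1}^{m}A^{1/p}(\alpha_i wf^{p})\,A^{1/q}(\alpha_i wg^{q})\le A^{1/p}(wf^{p})\,A^{1/q}(wg^{q}).$$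
   Context: Conditions on the class $L$ of functions $E\to\mathbb{R}$: (L1) if $f,g\in L$ then $\lambda f+\mu g\in L$ for all $\lambda,\mu\in\mathbb{R}$; (L2) the constant function $1$ belongs to $L$. Conditions on $A:L\to\mathbb{R}$: (A1) $A(\lambda f+\mu g)=\lambda A(f)+\mu A(g)$ for all $f,g\in L$ and $\lambda,\mu\in\mathbb{R}$; (A2) if $f\in L$ and $f(t)\ge 0$ for all $t\in E$, then $A(f)\ge 0$. Such an $A$ is called an isotonic linear functional. Notation: $A^{1/p}(h)$ means $(A(h))^{1/p}$; products and powers of functions are pointwise. *)

theory Defs
  imports Complex_Main "HOL-Library.FuncSet"
begin

text \<open>
  A function \<open>E \<rightarrow> \<real>\<close> is represented by its extensional version, i.e. by a member of
  \<^term>\<open>extensional E\<close>, written \<open>\<lambda>t\<in>E. \<dots>\<close>. A functional on \<open>L\<close> is a total function on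
  \<^typ>\<open>'a \<Rightarrow> real\<close> whose values outside \<open>L\<close> are irrelevant.
\<close>

definition linear_class :: "'a set \<Rightarrow> ('a \<Rightarrow> real) set \<Rightarrow> bool" where
  "linear_class E L \<longleftrightarrow>
     L \<subseteq> extensional E \<and>
     (\<forall>f\<in>L. \<forall>g\<in>L. \<forall>a b :: real. (\<lambda>t\<in>E. a * f t + b * g t) \<in> L) \<and>
     (\<lambda>t\<in>E. 1) \<in> L"

definition isotonic_linear_functional ::
    "'a set \<Rightarrow> ('a \<Rightarrow> real) set \<Rightarrow> (('a \<Rightarrow> real) \<Rightarrow> real) \<Rightarrow> bool" where
  "isotonic_linear_functional E L A \<longleftrightarrow>
     (\<forall>f\<in>L. \<forall>g\<in>L. \<forall>a b :: real. A (\<lambda>t\<in>E. a * f t + b * g t) = a * A f + b * A g) \<and>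
     (\<forall>f\<in>L. (\<forall>t\<in>E. f t \<ge> 0) \<longrightarrow> A f \<ge> 0)"

end

theory Submission
  imports Defs "HOL-Analysis.Convex"
begin

text \<open>
  Hoelder's inequality for \<open>A\<close> follows from Young's inequality applied pointwise to the functions
  normalised by their \<open>A\<close>-values. Applied to the weights \<open>\<alpha>\<^sub>i w\<close> it gives (i) after
  summing over \<open>i\<close>. Finite sums over \<open>{1..m}\<close> are themselves an isotonic linear functional,
  and Hoelder's inequality for that functional gives (ii).
\<close>

lemma linear_class_combination:
  assumes "linear_class E L" "f \<in> L" "g \<in> L"
  shows "(\<lambda>t\<in>E. a * f t + b * g t) \<in> L"
  using assms unfolding linear_class_def by blast

lemma functional_combination:
  assumes "isotonic_linear_functional E L A" "f \<in> L" "g \<in> L"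
  shows "A (\<lambda>t\<in>E. a * f t + b * g t) = a * A f + b * A g"
  using assms unfolding isotonic_linear_functional_def by blast

lemma functional_nonneg:
  assumes "isotonic_linear_functional E L A" "f \<in> L" "\<And>t. t \<in> E \<Longrightarrow> f t \<ge> 0"
  shows "A f \<ge> 0"
  using assms unfolding isotonic_linear_functional_def by blast

lemma functional_mono:
  assumes L: "linear_class E L" and A: "isotonic_linear_functional E L A"
    and f: "f \<in> L" and g: "g \<in> L" and le: "\<And>t. t \<in> E \<Longrightarrow> f t \<le> g t"
  shows "A f \<le> A g"
proof -
  have "0 \<le> A (\<lambda>t\<in>E. 1 * g t + (-1) * f t)"
    by (rule functional_nonneg [OF A linear_class_combination [OF L g f]]) (simp add: le)
  then show ?thesis
    by (simp only: functional_combination [OF A g f])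
qed

text \<open>Induction on \<open>I\<close>. Membership and value are proved together, since
  additivity of \<open>A\<close> at the step requires the partial sum to lie in
  \<open>L\<close>.\<close>

lemma functional_sum:
  assumes L: "linear_class E L" and A: "isotonic_linear_functional E L A"
    and "finite I" and "\<And>i. i \<in> I \<Longrightarrow> (\<lambda>t\<in>E. h i t) \<in> L"
  shows "(\<lambda>t\<in>E. \<Sum>i\<in>I. h i t) \<in> L \<and> A (\<lambda>t\<in>E. \<Sum>i\<in>I. h i t) = (\<Sum>i\<in>I. A (\<lambda>t\<in>E. h i t))"
  using assms(3,4)
proof (induction I rule: finite_induct)
  case empty
  have one: "(\<lambda>t\<in>E. 1) \<in> L"
    using L unfolding linear_class_def by blast
  \<comment> \<open>The zero function is a combination of two copies of the constant 1, the one
    element that \<open>L\<close> is certain to contain.\<close>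
  have "(\<lambda>t\<in>E. 0) = (\<lambda>t\<in>E. 0 * (\<lambda>t\<in>E. 1) t + 0 * (\<lambda>t\<in>E. 1) t :: real)"
    by (rule restrict_ext) simp
  then have "(\<lambda>t\<in>E. 0) \<in> L" and "A (\<lambda>t\<in>E. 0) = 0"
    using linear_class_combination [OF L one one, of 0 0]
      functional_combination [OF A one one, of 0 0] by simp_all
  then show ?case
    by (simp only: sum.empty)
next
  case (insert j I)
  have hj: "(\<lambda>t\<in>E. h j t) \<in> L"
    by (rule insert.prems) (rule insertI1)
  have IH: "(\<lambda>t\<in>E. \<Sum>i\<in>I. h i t) \<in> L \<and> A (\<lambda>t\<in>E. \<Sum>i\<in>I. h i t) = (\<Sum>i\<in>I. A (\<lambda>t\<in>E. h i t))"
    by (rule insert.IH [OF insert.prems]) (rule insertI2)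
  note hI = conjunct1 [OF IH] and AI = conjunct2 [OF IH]
  have eq: "(\<lambda>t\<in>E. \<Sum>i\<in>insert j I. h i t)
      = (\<lambda>t\<in>E. 1 * (\<lambda>t\<in>E. h j t) t + 1 * (\<lambda>t\<in>E. \<Sum>i\<in>I. h i t) t)"
    using insert.hyps by (intro restrict_ext) simp
  have "(\<lambda>t\<in>E. \<Sum>i\<in>insert j I. h i t) \<in> L"
    unfolding eq by (rule linear_class_combination [OF L hj hI])
  moreover have "A (\<lambda>t\<in>E. \<Sum>i\<in>insert j I. h i t) = (\<Sum>i\<in>insert j I. A (\<lambda>t\<in>E. h i t))"
    unfolding eq functional_combination [OF A hj hI]
    by (simp only: mult_1 AI sum.insert [OF insert.hyps])
  ultimately show ?case ..
qed

text \<open>Young's inequality for positive arguments, extended to the boundary: if \<open>a\<close>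
  or \<open>b\<close> is 0, the left side vanishes because \<open>0 powr x = 0\<close>.\<close>

lemma Youngs_inequality_nonneg:
  fixes a b :: real
  assumes "0 < \<alpha>" "0 < \<beta>" "\<alpha> + \<beta> = 1" "a \<ge> 0" "b \<ge> 0"
  shows "a powr \<alpha> * b powr \<beta> \<le> \<alpha> * a + \<beta> * b"
proof (cases "a = 0 \<or> b = 0")
  case False
  then show ?thesis
    using assms by (intro Youngs_inequality_0) auto
qed (use assms in auto)

lemma conjugate_exponent_pos:
  fixes p q :: real
  assumes "p > 1" and "1 / p + 1 / q = 1"
  shows "q > 0"
proof -
  have "1 / p < 1"
    using assms(1) by simp
  then have "1 / q > 0"
    using assms(2) by linarith
  then show ?thesis
    by simp
qed

text \<open>\<open>F\<close> and \<open>G\<close> play the roles of the weighted powers of two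
  functions, so \<open>L\<close> need not be closed under products or powers. A pointwise bound on
  \<open>H\<close> is enough because \<open>A\<close> is monotone.\<close>

lemma isotonic_Holder:
  assumes L: "linear_class E L" and A: "isotonic_linear_functional E L A"
    and p: "p > 1" and pq: "1 / p + 1 / q = 1"
    and F: "F \<in> L" and G: "G \<in> L" and H: "H \<in> L"
    and F0: "\<And>t. t \<in> E \<Longrightarrow> F t \<ge> 0" and G0: "\<And>t. t \<in> E \<Longrightarrow> G t \<ge> 0"
    and le: "\<And>t. t \<in> E \<Longrightarrow> H t \<le> F t powr (1 / p) * G t powr (1 / q)"
  shows "A H \<le> A F powr (1 / p) * A G powr (1 / q)"
proof -
  have pos: "1 / p > 0" "1 / q > 0"
    using p conjugate_exponent_pos [OF p pq] by simp_all
  have AF: "A F \<ge> 0" and AG: "A G \<ge> 0"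
    using functional_nonneg [OF A] F G F0 G0 by blast+
  \<comment> \<open>Dividing by \<open>A F + e\<close> and \<open>A G + e\<close> avoids treating \<open>A F = 0\<close> and \<open>A G = 0\<close> separately.\<close>
  have perturbed: "A H \<le> (A F + e) powr (1 / p) * (A G + e) powr (1 / q)" if e: "e > 0" for e
  proof -
    define X Y K where "X = A F + e" and "Y = A G + e" and "K = X powr (1 / p) * Y powr (1 / q)"
    have X: "X > 0" and Y: "Y > 0"
      using AF AG e by (auto simp: X_def Y_def)
    have K: "K > 0"
      using X Y by (simp add: K_def)
    have young: "H t \<le> (K / (p * X)) * F t + (K / (q * Y)) * G t" if t: "t \<in> E" for t
    proof -
      \<comment> \<open>Pulling out \<open>K\<close> leaves Young's inequality for
        \<open>F t / X\<close> and \<open>G t / Y\<close> with weights \<open>1 / p\<close> and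
        \<open>1 / q\<close>. The resulting bound is linear in \<open>F t\<close> and
        \<open>G t\<close>, so \<open>A\<close> can be evaluated on it.\<close>
      have "F t powr (1 / p) * G t powr (1 / q)
          = K * ((F t / X) powr (1 / p) * (G t / Y) powr (1 / q))"
        using X Y F0 [OF t] G0 [OF t] by (simp add: K_def powr_divide)
      also have "\<dots> \<le> K * (1 / p * (F t / X) + 1 / q * (G t / Y))"
        using K X Y F0 [OF t] G0 [OF t] pos pq
        by (intro mult_left_mono Youngs_inequality_nonneg) auto
      also have "\<dots> = (K / (p * X)) * F t + (K / (q * Y)) * G t"
        by (simp add: algebra_simps)
      finally show ?thesis
        using le [OF t] by simp
    qed
    have "A H \<le> A (\<lambda>t\<in>E. (K / (p * X)) * F t + (K / (q * Y)) * G t)"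
      by (rule functional_mono [OF L A H linear_class_combination [OF L F G]]) (use young in simp)
    also have "\<dots> = K * (1 / p * (A F / X) + 1 / q * (A G / Y))"
      by (subst functional_combination [OF A F G]) (simp add: algebra_simps)
    \<comment> \<open>Both quotients are at most 1, as \<open>X\<close> and \<open>Y\<close> exceed
      \<open>A F\<close> and \<open>A G\<close> by \<open>e\<close>; the weights then add up to
      1.\<close>
    also have "\<dots> \<le> K * (1 / p * 1 + 1 / q * 1)"
      using X Y K pos e
      by (intro mult_left_mono add_mono) (auto simp: X_def Y_def)
    finally show ?thesis
      using pq by (simp add: K_def X_def Y_def)
  qed
  \<comment> \<open>Let \<open>e\<close> tend to 0 from the right. The exponents are positive, so
    the powers are continuous there even when \<open>A F\<close> or \<open>A G\<close> is 0.\<close>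
  have "((\<lambda>e. (A F + e) powr (1 / p) * (A G + e) powr (1 / q)) \<longlongrightarrow>
      (A F + 0) powr (1 / p) * (A G + 0) powr (1 / q)) (at_right 0)"
    using AF AG pos
    by (intro tendsto_mult tendsto_powr' tendsto_add tendsto_const tendsto_ident_at)
      (auto intro!: eventually_at_rightI [of 0 1])
  then have "A H \<le> (A F + 0) powr (1 / p) * (A G + 0) powr (1 / q)"
    by (rule tendsto_lowerbound)
      (auto intro!: eventually_at_rightI [of 0 1] perturbed)
  then show ?thesis
    by simp
qed

lemma linear_class_extensional: "linear_class E (extensional E)"
  by (auto simp: linear_class_def)

text \<open>For infinite \<open>E\<close> the sum is 0 by convention, and the zero functional is
  linear and isotonic as well.\<close>

lemma isotonic_linear_functional_sum:
  "isotonic_linear_functional E (extensional E) (\<lambda>h. \<Sum>i\<in>E. h i)"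
  by (auto simp: isotonic_linear_functional_def sum.distrib sum_distrib_left sum_nonneg)

text \<open>The index set \<open>I\<close> takes the place of \<open>E\<close> in
  \<open>isotonic_Holder\<close>; \<open>restrict\<close> turns the families into members of
  \<open>extensional I\<close>.\<close>

lemma Holder_sum:
  fixes x y :: "'i \<Rightarrow> real"
  assumes "p > 1" and "1 / p + 1 / q = 1"
    and "\<And>i. i \<in> I \<Longrightarrow> x i \<ge> 0" and "\<And>i. i \<in> I \<Longrightarrow> y i \<ge> 0"
  shows "(\<Sum>i\<in>I. x i powr (1 / p) * y i powr (1 / q))
    \<le> (\<Sum>i\<in>I. x i) powr (1 / p) * (\<Sum>i\<in>I. y i) powr (1 / q)"
  using isotonic_Holder [OF linear_class_extensional isotonic_linear_functional_sum assms(1,2),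
      of "restrict x I" I "restrict y I" "\<lambda>i\<in>I. x i powr (1 / p) * y i powr (1 / q)"] assms(3,4)
  by simp

theorem theorem7:
  fixes E :: "'a set"
    and L :: "('a \<Rightarrow> real) set"
    and A :: "('a \<Rightarrow> real) \<Rightarrow> real"
    and p q :: real
    and m :: nat
    and \<alpha> :: "nat \<Rightarrow> 'a \<Rightarrow> real"
    and w f g :: "'a \<Rightarrow> real"
  assumes "E \<noteq> {}"
    and "linear_class E L"
    and "isotonic_linear_functional E L A"
    and "p > 1"
    and "1 / p + 1 / q = 1"
    and "m \<ge> 1"
    and "\<And>i t. i \<in> {1..m} \<Longrightarrow> t \<in> E \<Longrightarrow> \<alpha> i t \<ge> 0"
    and "\<And>t. t \<in> E \<Longrightarrow> w t \<ge> 0"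
    and "\<And>t. t \<in> E \<Longrightarrow> f t \<ge> 0"
    and "\<And>t. t \<in> E \<Longrightarrow> g t \<ge> 0"
    and "\<And>t. t \<in> E \<Longrightarrow> (\<Sum>i=1..m. \<alpha> i t) = 1"
    and "(\<lambda>t\<in>E. w t * f t * g t) \<in> L"
    and "\<And>i. i \<in> {1..m} \<Longrightarrow> (\<lambda>t\<in>E. \<alpha> i t * w t * f t * g t) \<in> L"
    and "\<And>i. i \<in> {1..m} \<Longrightarrow> (\<lambda>t\<in>E. \<alpha> i t * w t * f t powr p) \<in> L"
    and "\<And>i. i \<in> {1..m} \<Longrightarrow> (\<lambda>t\<in>E. \<alpha> i t * w t * g t powr q) \<in> L"
  shows "A (\<lambda>t\<in>E. w t * f t * g t)
           \<le> (\<Sum>i=1..m. A (\<lambda>t\<in>E. \<alpha> i t * w t * f t powr p) powr (1 / p)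
                       * A (\<lambda>t\<in>E. \<alpha> i t * w t * g t powr q) powr (1 / q))
       \<and> (\<Sum>i=1..m. A (\<lambda>t\<in>E. \<alpha> i t * w t * f t powr p) powr (1 / p)
                       * A (\<lambda>t\<in>E. \<alpha> i t * w t * g t powr q) powr (1 / q))
           \<le> A (\<lambda>t\<in>E. w t * f t powr p) powr (1 / p)
             * A (\<lambda>t\<in>E. w t * g t powr q) powr (1 / q)"
proof -
  let ?F = "\<lambda>i. \<lambda>t\<in>E. \<alpha> i t * w t * f t powr p"
  let ?G = "\<lambda>i. \<lambda>t\<in>E. \<alpha> i t * w t * g t powr q"
  let ?H = "\<lambda>i. \<lambda>t\<in>E. \<alpha> i t * w t * f t * g t"
  note L = assms(2) and A = assms(3) and p = assms(4) and pq = assms(5)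
    and \<alpha> = assms(7) and w = assms(8) and f = assms(9) and g = assms(10) and one = assms(11)
    and H = assms(13) and F = assms(14) and G = assms(15)
  note q = conjugate_exponent_pos [OF p pq]
  have F0: "?F i t \<ge> 0" and G0: "?G i t \<ge> 0" if "i \<in> {1..m}" "t \<in> E" for i t
    using that \<alpha> w by simp_all
  have local_Holder: "A (?H i) \<le> A (?F i) powr (1 / p) * A (?G i) powr (1 / q)" if i: "i \<in> {1..m}" for i
  proof (rule isotonic_Holder [OF L A p pq F [OF i] G [OF i] H [OF i] F0 [OF i] G0 [OF i]])
    fix t assume t: "t \<in> E"
    define u where "u = \<alpha> i t * w t"
    have u: "u \<ge> 0"
      using \<alpha> [OF i t] w [OF t] by (simp add: u_def)
    \<comment> \<open>The weight is distributed over both factors, and its exponents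
      \<open>1 / p\<close> and \<open>1 / q\<close> recombine to 1. The pointwise bound thus holds
      with equality.\<close>
    have "(u * f t powr p) powr (1 / p) * (u * g t powr q) powr (1 / q)
        = u powr (1 / p + 1 / q) * f t * g t"
      using u f [OF t] g [OF t] p q by (simp add: powr_mult powr_powr powr_add)
    also have "\<dots> = u * f t * g t"
      using u by (simp add: pq)
    finally show "?H i t \<le> ?F i t powr (1 / p) * ?G i t powr (1 / q)"
      using t by (simp add: u_def)
  qed
  \<comment> \<open>The \<alpha> i form a partition of unity, so \<open>A\<close> of the whole is
    the sum over the pieces. Taking \<open>h\<close> to be \<open>f * g\<close>,
    \<open>f powr p\<close> and \<open>g powr q\<close> in turn covers all three uses.\<close>
  have split: "A (\<lambda>t\<in>E. w t * h t) = (\<Sum>i=1..m. A (\<lambda>t\<in>E. \<alpha> i t * w t * h t))"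
    if "\<And>i. i \<in> {1..m} \<Longrightarrow> (\<lambda>t\<in>E. \<alpha> i t * w t * h t) \<in> L" for h
  proof -
    have "(\<lambda>t\<in>E. w t * h t) = (\<lambda>t\<in>E. \<Sum>i=1..m. \<alpha> i t * w t * h t)"
      by (rule restrict_ext) (simp add: one sum_distrib_right [symmetric] del: One_nat_def)
    then show ?thesis
      using functional_sum [OF L A finite_atLeastAtMost, of 1 m, OF that] by (simp only:)
  qed
  have "A (\<lambda>t\<in>E. w t * f t * g t) = (\<Sum>i=1..m. A (?H i))"
    using split [of "\<lambda>t. f t * g t"] H by (simp add: mult.assoc)
  also have "\<dots> \<le> (\<Sum>i=1..m. A (?F i) powr (1 / p) * A (?G i) powr (1 / q))"
    by (rule sum_mono) (rule local_Holder)
  finally have "A (\<lambda>t\<in>E. w t * f t * g t)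
      \<le> (\<Sum>i=1..m. A (?F i) powr (1 / p) * A (?G i) powr (1 / q))" .
  \<comment> \<open>The discrete inequality is applied to the numbers \<open>A (?F i)\<close> and
    \<open>A (?G i)\<close>, nonnegative by positivity of \<open>A\<close>; \<open>split\<close>
    then identifies their sums.\<close>
  moreover have "(\<Sum>i=1..m. A (?F i) powr (1 / p) * A (?G i) powr (1 / q))
      \<le> (\<Sum>i=1..m. A (?F i)) powr (1 / p) * (\<Sum>i=1..m. A (?G i)) powr (1 / q)"
    using functional_nonneg [OF A F F0] functional_nonneg [OF A G G0]
    by (intro Holder_sum p pq)
  ultimately show ?thesis
    using split [OF F] split [OF G] by simp
qed

end
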